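(* Let $G=(V,E)$ be a finite graph with symmetric positive edge weights $w_{xy}=w_{yx}>0$ and a finite measure $\mu:V\to(0,\infty)$, let $\Delta$ be the associated $\mu$-Laplacian, and let $h:V\to\mathbb{R}$ be a function with $h\not\equiv 0$. Then the equation $$\Delta u=-he^{u}\quad\text{in } V$$ has a solution $u:V\to\mathbb{R}$ if and only if $h$ changes sign and $\int_V h\,d\mu<0$.
   Context: For $u:V\to\mathbb{R}$, the $\mu$-Laplacian is $\Delta u(x)=\frac{1}{\mu(x)}\sum_{y\sim x}w_{xy}(u(y)-u(x))$, where $y\sim x$ means $xy\in E$. For $g:V\to\mathbb{R}$, $\int_V g\,d\mu=\sum_{x\in V}\mu(x)g(x)$. "$h$ changes sign" means that $h$ is positive at some vertex and negative at some vertex.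
   Formalization: The graph G is additionally assumed connected; without this the claim is false, e.g. for two isolated vertices with measure 1 and h = 1, −2, where h changes sign and has negative integral but no solution exists. *)

theory Defs
  imports "HOL-Analysis.Analysis" "Graph_Theory.Graph_Theory"
begin

(* An undirected graph is a symmetric digraph (locale pair_graph): an edge xy is the pair of arcs
   (x,y), (y,x). Functions on the vertex set are total functions on the type 'a; only their values
   on pverts G (for w: on parcs G) are ever used. *)

definition mu_laplacian ::
  "'a pair_pre_digraph \<Rightarrow> ('a \<Rightarrow> 'a \<Rightarrow> real) \<Rightarrow> ('a \<Rightarrow> real) \<Rightarrow> ('a \<Rightarrow> real) \<Rightarrow> 'a \<Rightarrow> real" where
  "mu_laplacian G w \<mu> u x =
     (1 / \<mu> x) * (\<Sum>y\<in>{y. x \<rightarrow>\<^bsub>with_proj G\<^esub> y}. w x y * (u y - u x))"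

definition vertex_integral ::
  "'a pair_pre_digraph \<Rightarrow> ('a \<Rightarrow> real) \<Rightarrow> ('a \<Rightarrow> real) \<Rightarrow> real" where
  "vertex_integral G \<mu> g = (\<Sum>x\<in>pverts G. \<mu> x * g x)"

definition changes_sign :: "'a pair_pre_digraph \<Rightarrow> ('a \<Rightarrow> real) \<Rightarrow> bool" where
  "changes_sign G h \<longleftrightarrow> (\<exists>x\<in>pverts G. h x > 0) \<and> (\<exists>x\<in>pverts G. h x < 0)"

end

(* Necessity: summing the equation against mu, and then against mu e^(-u), gives
   int h e^u = 0 and int h = - int e^(-u) Delta u < 0 (the latter because e^(-u) decreases in u).
   Sufficiency: minimise the Dirichlet energy over the closed set {u. int h e^u >= 0}, which is
   invariant under adding constants, so that minimising sequences may be normalised at a vertex.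
   The inequality constraint makes a minimiser u satisfy - Delta u = l h e^u with l >= 0 by first
   order variations alone; l = 0 would make u constant, against int h < 0, and so u + ln l solves
   the equation. *)
theory Submission
  imports Defs
begin

text \<open>Source of the Lagrange multiplier and its sign. Let \<open>r\<close> be the part of
  \<open>q\<close> orthogonal to \<open>p\<close>. The vectors \<open>e * p - r\<close> with
  \<open>e > 0\<close> lie in the half-space, but \<open>q\<close> becomes negative on them for
  small \<open>e\<close> unless \<open>r\<close> vanishes. Testing with \<open>p\<close> itself
  gives the sign.\<close>

lemma nonneg_multiplier_if_halfspace:
  fixes p q :: "'a \<Rightarrow> real"
  assumes "finite V" and "x0 \<in> V" and "p x0 \<noteq> 0"
    and half: "\<And>v. (\<Sum>x\<in>V. v x * p x) > 0 \<Longrightarrow> (\<Sum>x\<in>V. v x * q x) \<ge> 0"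
  obtains l where "l \<ge> 0" and "\<And>x. x \<in> V \<Longrightarrow> q x = l * p x"
proof -
  define P where "P = (\<Sum>x\<in>V. p x * p x)"
  define c where "c = (\<Sum>x\<in>V. p x * q x)"
  define l where "l = c / P"
  define r where "r x = q x - l * p x" for x
  define R where "R = (\<Sum>x\<in>V. r x * r x)"
  have "P > 0"
    unfolding P_def using assms(1-3) by (intro sum_pos2[of _ x0]) (auto simp: zero_less_mult_iff)
  have "c \<ge> 0" using half[of p] \<open>P > 0\<close> by (simp add: P_def c_def)
  have rp: "(\<Sum>x\<in>V. r x * p x) = 0"
  proof -
    have "(\<Sum>x\<in>V. r x * p x) = c - l * P"
      by (simp add: r_def c_def P_def left_diff_distrib right_diff_distrib sum_subtractf sum_distrib_left mult_ac)
    then show ?thesis using \<open>P > 0\<close> by (simp add: l_def)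
  qed
  have rq: "(\<Sum>x\<in>V. r x * q x) = R"
  proof -
    have "(\<Sum>x\<in>V. r x * q x) = R + l * (\<Sum>x\<in>V. r x * p x)"
      unfolding R_def sum_distrib_left sum.distrib[symmetric]
      by (rule sum.cong) (auto simp: r_def algebra_simps)
    then show ?thesis using rp by simp
  qed
  have "R \<ge> 0" unfolding R_def by (intro sum_nonneg) simp
  have "R = 0"
  proof (rule ccontr)
    assume "R \<noteq> 0"
    with \<open>R \<ge> 0\<close> have "R > 0" by simp
    \<comment> \<open>The choice ensures \<open>e * c < R\<close>; the summand 1 covers the case
      \<open>c = 0\<close>.\<close>
    define e where "e = R / (c + 1)"
    have "e > 0" using \<open>R > 0\<close> \<open>c \<ge> 0\<close> by (simp add: e_def)
    have "(\<Sum>x\<in>V. (e * p x - r x) * p x) = e * P"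
      using rp by (simp add: P_def left_diff_distrib sum_subtractf sum_distrib_left mult.assoc)
    then have "(\<Sum>x\<in>V. (e * p x - r x) * q x) \<ge> 0"
      using \<open>e > 0\<close> \<open>P > 0\<close> by (intro half) simp
    moreover have "(\<Sum>x\<in>V. (e * p x - r x) * q x) = e * c - R"
      using rq by (simp add: c_def left_diff_distrib sum_subtractf sum_distrib_left mult.assoc)
    moreover have "e * c < R"
      using \<open>R > 0\<close> \<open>c \<ge> 0\<close> by (simp add: e_def field_simps)
    ultimately show False by simp
  qed
  then have "\<forall>x\<in>V. r x * r x = 0"
    unfolding R_def using \<open>finite V\<close> by (subst (asm) sum_nonneg_eq_0_iff) auto
  then have "\<And>x. x \<in> V \<Longrightarrow> q x = l * p x" by (auto simp: r_def)
  then show thesis using that[of l] \<open>c \<ge> 0\<close> \<open>P > 0\<close> by (simp add: l_def)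
qed

text \<open>A graph is encoded by a weight that vanishes off its edges, so that all sums can run
  over \<open>V\<close>. Connectedness is stated through chains of positive weights, ready for
  induction along a path.\<close>

locale connected_weights =
  fixes V :: "'a set" and a :: "'a \<Rightarrow> 'a \<Rightarrow> real"
  assumes finite_V: "finite V"
    and sym: "a x y = a y x"
    and nonneg: "a x y \<ge> 0"
    and conn: "x \<in> V \<Longrightarrow> y \<in> V \<Longrightarrow> (x, y) \<in> {(s, t). s \<in> V \<and> t \<in> V \<and> a s t > 0}\<^sup>*"
begin

section \<open>Laplacian, Dirichlet energy and Green's formula\<close>

definition lap :: "('a \<Rightarrow> real) \<Rightarrow> 'a \<Rightarrow> real" where
  "lap u x = (\<Sum>y\<in>V. a x y * (u y - u x))"

text \<open>Ordered pairs count each edge between distinct vertices twice, hence the factor 4 in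
  \<open>energy_add_smult\<close>.\<close>

definition energy :: "('a \<Rightarrow> real) \<Rightarrow> real" where
  "energy u = (\<Sum>x\<in>V. \<Sum>y\<in>V. a x y * (u y - u x)\<^sup>2)"

text \<open>Summation by parts: exchanging \<open>x\<close> and \<open>y\<close> and using the
  symmetry of \<open>a\<close> gives a second form of the double sum, and adding the two forms
  produces the differences of \<open>v\<close>.\<close>

lemma green:
  "2 * (\<Sum>x\<in>V. v x * lap u x) = - (\<Sum>x\<in>V. \<Sum>y\<in>V. a x y * (u y - u x) * (v y - v x))"
proof -
  let ?S = "\<Sum>x\<in>V. \<Sum>y\<in>V. v x * (a x y * (u y - u x))"
  have 1: "(\<Sum>x\<in>V. v x * lap u x) = ?S"
    by (simp add: lap_def sum_distrib_left)
  have "?S = (\<Sum>x\<in>V. \<Sum>y\<in>V. v y * (a y x * (u x - u y)))"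
    by (rule sum.swap)
  also have "\<dots> = (\<Sum>x\<in>V. \<Sum>y\<in>V. v y * (a x y * (u x - u y)))"
    by (simp add: sym)
  finally have "2 * ?S = ?S + (\<Sum>x\<in>V. \<Sum>y\<in>V. v y * (a x y * (u x - u y)))"
    by simp
  also have "\<dots> = - (\<Sum>x\<in>V. \<Sum>y\<in>V. a x y * (u y - u x) * (v y - v x))"
    unfolding sum.distrib[symmetric] sum_negf[symmetric]
    by (intro sum.cong) (auto simp: algebra_simps)
  finally show ?thesis using 1 by simp
qed

lemma sum_lap: "(\<Sum>x\<in>V. lap u x) = 0"
  using green[of "\<lambda>_. 1" u] by simp

lemma constant_if_constant_on_edges:
  assumes "\<And>s t. s \<in> V \<Longrightarrow> t \<in> V \<Longrightarrow> a s t > 0 \<Longrightarrow> u s = u t"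
    and "x \<in> V" and "y \<in> V"
  shows "u x = u y"
  using conn[OF assms(2,3)] by (induction rule: rtrancl_induct) (auto dest: assms(1))

text \<open>By connectedness, a nonconstant \<open>u\<close> takes different values at the ends of
  some edge. That edge contributes a positive term, and no term is negative.\<close>

lemma sum_edges_pos:
  assumes f: "\<And>x y. f x y \<ge> 0" and pos: "\<And>x y. u x \<noteq> u y \<Longrightarrow> f x y > 0"
    and "x \<in> V" and "y \<in> V" and "u x \<noteq> u y"
  shows "(\<Sum>x\<in>V. \<Sum>y\<in>V. a x y * f x y) > 0"
proof -
  obtain s t where st: "s \<in> V" "t \<in> V" "a s t > 0" "u s \<noteq> u t"
    using constant_if_constant_on_edges[of u x y] assms(3-5) by blast
  have nn: "(\<Sum>y\<in>V. a x y * f x y) \<ge> 0" for x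
    by (intro sum_nonneg mult_nonneg_nonneg nonneg f)
  have "(\<Sum>y\<in>V. a s y * f s y) > 0"
    using st pos[of s t] finite_V by (intro sum_pos2[of _ t]) (auto intro!: mult_nonneg_nonneg nonneg f)
  then show ?thesis
    using st(1) finite_V nn by (intro sum_pos2[of _ s "\<lambda>x. \<Sum>y\<in>V. a x y * f x y"]) auto
qed

text \<open>Green's formula with test function \<open>exp (- u)\<close>: along an edge,
  \<open>u\<close> and \<open>exp (- u)\<close> change in opposite directions.\<close>

lemma sum_lap_exp_neg_pos:
  assumes "x \<in> V" and "y \<in> V" and "u x \<noteq> u y"
  shows "(\<Sum>x\<in>V. exp (- u x) * lap u x) > 0"
proof -
  have "(\<Sum>x\<in>V. \<Sum>y\<in>V. a x y * ((u y - u x) * (exp (- u x) - exp (- u y)))) > 0"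
  proof (rule sum_edges_pos[where u = u, OF _ _ assms])
    fix x y
    show "(u y - u x) * (exp (- u x) - exp (- u y)) \<ge> 0"
      by (cases "u x \<le> u y") (auto intro: mult_nonneg_nonneg mult_nonpos_nonpos)
    assume "u x \<noteq> u y"
    then show "(u y - u x) * (exp (- u x) - exp (- u y)) > 0"
      by (cases "u x < u y") (auto intro: mult_pos_pos mult_neg_neg)
  qed
  moreover have "2 * (\<Sum>x\<in>V. exp (- u x) * lap u x)
      = (\<Sum>x\<in>V. \<Sum>y\<in>V. a x y * ((u y - u x) * (exp (- u x) - exp (- u y))))"
    unfolding green sum_negf[symmetric] by (intro sum.cong) (auto simp: algebra_simps)
  ultimately show ?thesis by simp
qed

text \<open>Green's formula tested with \<open>u\<close> itself. It serves to exclude a zero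
  multiplier, which would make \<open>u\<close> harmonic.\<close>

lemma sum_lap_self_neg:
  assumes "x \<in> V" and "y \<in> V" and "u x \<noteq> u y"
  shows "(\<Sum>x\<in>V. u x * lap u x) < 0"
proof -
  have "(\<Sum>x\<in>V. \<Sum>y\<in>V. a x y * (u y - u x)\<^sup>2) > 0"
    by (rule sum_edges_pos[where u = u, OF _ _ assms]) auto
  then show ?thesis
    using green[of u u] by (simp add: power2_eq_square mult.assoc)
qed

section \<open>Minimising the energy under the exponential constraint\<close>

lemma energy_nonneg: "energy u \<ge> 0"
  unfolding energy_def by (intro sum_nonneg mult_nonneg_nonneg nonneg) simp

lemma energy_add_smult:
  "energy (\<lambda>x. u x + t * v x) = energy u - 4 * t * (\<Sum>x\<in>V. v x * lap u x) + t\<^sup>2 * energy v"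
proof -
  have "energy (\<lambda>x. u x + t * v x) = energy u
      + 2 * t * (\<Sum>x\<in>V. \<Sum>y\<in>V. a x y * (u y - u x) * (v y - v x)) + t\<^sup>2 * energy v"
    unfolding energy_def sum_distrib_left sum.distrib[symmetric]
    by (intro sum.cong) (auto simp: algebra_simps power2_eq_square)
  also have "(\<Sum>x\<in>V. \<Sum>y\<in>V. a x y * (u y - u x) * (v y - v x)) = - 2 * (\<Sum>x\<in>V. v x * lap u x)"
    using green[of v u] by simp
  finally show ?thesis by simp
qed

lemma edge_le_energy:
  assumes "s \<in> V" and "t \<in> V"
  shows "a s t * (u t - u s)\<^sup>2 \<le> energy u"
proof -
  have "a s t * (u t - u s)\<^sup>2 \<le> (\<Sum>y\<in>V. a s y * (u y - u s)\<^sup>2)"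
    using assms finite_V nonneg by (intro member_le_sum) auto
  also have "\<dots> \<le> energy u"
    unfolding energy_def using assms finite_V nonneg
    by (intro member_le_sum[where f = "\<lambda>x. \<Sum>y\<in>V. a x y * (u y - u x)\<^sup>2"]) (auto intro!: sum_nonneg)
  finally show ?thesis .
qed

text \<open>Coercivity modulo constants: on a path from \<open>b\<close> to \<open>x\<close>, each
  edge changes \<open>u\<close> by at most \<open>sqrt (M / a s t)\<close>, a bound independent of
  \<open>u\<close>.\<close>

lemma energy_bounds_differences:
  assumes "b \<in> V" and "x \<in> V"
  shows "\<exists>C. \<forall>u. energy u \<le> M \<longrightarrow> \<bar>u x - u b\<bar> \<le> C"
  using conn[OF assms]
proof (induction rule: rtrancl_induct)
  case base
  show ?case by (rule exI[of _ 0]) simp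
next
  case (step s t)
  then obtain C where C: "\<And>u. energy u \<le> M \<Longrightarrow> \<bar>u s - u b\<bar> \<le> C" by blast
  have st: "s \<in> V" "t \<in> V" "a s t > 0" using step.hyps by auto
  have "\<bar>u t - u b\<bar> \<le> C + sqrt (M / a s t)" if "energy u \<le> M" for u
  proof -
    have "a s t * (u t - u s)\<^sup>2 \<le> M" using edge_le_energy[OF st(1,2), of u] that by simp
    then have "(u t - u s)\<^sup>2 \<le> M / a s t" using st(3) by (simp add: field_simps)
    then have "\<bar>u t - u s\<bar> \<le> sqrt (M / a s t)" by (metis real_sqrt_abs real_sqrt_le_iff)
    then show ?thesis using C[OF that] by linarith
  qed
  then show ?case by blast
qed

lemma continuous_on_energy: "continuous_on S energy"
proof -
  have "continuous_on UNIV energy"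
    unfolding energy_def[abs_def] by (intro continuous_intros continuous_on_product_coordinates)
  then show ?thesis by (rule continuous_on_subset) simp
qed

text \<open>Adding a constant to \<open>u\<close> preserves the energy and multiplies the constraint
  sum by a positive factor. Candidates can therefore be normalised at \<open>b\<close>, and those
  with energy at most that of \<open>u0\<close> then lie in a compact box.\<close>

lemma exp_constrained_minimiser:
  fixes k :: "'a \<Rightarrow> real"
  assumes "b \<in> V" and "(\<Sum>x\<in>V. k x * exp (u0 x)) \<ge> 0"
  obtains u where "(\<Sum>x\<in>V. k x * exp (u x)) \<ge> 0"
    and "\<And>v. (\<Sum>x\<in>V. k x * exp (v x)) \<ge> 0 \<Longrightarrow> energy u \<le> energy v"
proof -
  define K where "K u = (\<Sum>x\<in>V. k x * exp (u x))" for u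
  \<comment> \<open>Besides vanishing at \<open>b\<close>, \<open>N u\<close> is 0 outside
    \<open>V\<close>, which confines the irrelevant coordinates to a point.\<close>
  define N where "N u x = (if x \<in> V then u x - u b else 0)" for u :: "'a \<Rightarrow> real" and x
  define M where "M = energy u0"
  have "\<forall>x\<in>V. \<exists>C. \<forall>u. energy u \<le> M \<longrightarrow> \<bar>u x - u b\<bar> \<le> C"
    using energy_bounds_differences[OF \<open>b \<in> V\<close>] by blast
  then obtain C where C: "\<And>x u. x \<in> V \<Longrightarrow> energy u \<le> M \<Longrightarrow> \<bar>u x - u b\<bar> \<le> C x"
    by metis
  \<comment> \<open>A product of intervals and singletons over the whole type, compact by Tychonoff
    in the topology of pointwise convergence.\<close>
  define B :: "('a \<Rightarrow> real) set" where "B = PiE UNIV (\<lambda>x. if x \<in> V then {- C x..C x} else {0})"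
  have energy_N: "energy (N u) = energy u" for u
    unfolding energy_def N_def by (intro sum.cong) auto
  have "K (N u) = exp (- u b) * K u" for u
    unfolding K_def N_def sum_distrib_left by (intro sum.cong) (auto simp: exp_diff exp_minus field_simps)
  then have K_N: "K (N u) \<ge> 0" if "K u \<ge> 0" for u
    using that by simp
  have N_B: "N u \<in> B" if "energy u \<le> M" for u
    using C[OF _ that] unfolding B_def N_def PiE_iff by (simp add: abs_le_iff algebra_simps)
  have "compactin euclidean B"
    unfolding B_def euclidean_product_topology[symmetric] compactin_PiE by auto
  then have "compact B" by simp
  moreover have "closed {u. K u \<ge> 0}"
    unfolding K_def by (intro closed_Collect_le continuous_intros continuous_on_product_coordinates)
  ultimately have "compact (B \<inter> {u. K u \<ge> 0})" by (rule compact_Int_closed)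
  moreover have N0: "N u0 \<in> B \<inter> {u. K u \<ge> 0}"
    using N_B[of u0] K_N[of u0] assms(2) by (auto simp: M_def K_def)
  ultimately obtain u where u: "u \<in> B \<inter> {u. K u \<ge> 0}"
    and min: "\<And>v. v \<in> B \<inter> {u. K u \<ge> 0} \<Longrightarrow> energy u \<le> energy v"
    using continuous_attains_inf[of "B \<inter> {u. K u \<ge> 0}" energy] continuous_on_energy by (metis empty_iff)
  have "energy u \<le> energy v" if "K v \<ge> 0" for v
  proof (cases "energy v \<le> M")
    case True
    then show ?thesis using min[of "N v"] N_B K_N[OF that] energy_N by simp
  next
    \<comment> \<open>A competitor outside the sublevel set already loses to
      \<open>N u0\<close>.\<close>
    case False
    then show ?thesis using min[OF N0] energy_N[of u0] by (simp add: M_def)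
  qed
  then show thesis using that[of u] u by (simp add: K_def)
qed

text \<open>The constraint sum has positive derivative in direction \<open>v\<close>, so small
  positive steps stay feasible even if the constraint is active. A positive \<open>Q\<close> would
  make the linear term of the energy expansion, \<open>- 4 * t * Q\<close>, beat the quadratic
  one.\<close>

lemma minimiser_variation:
  fixes k :: "'a \<Rightarrow> real"
  assumes feasible: "(\<Sum>x\<in>V. k x * exp (u x)) \<ge> 0"
    and min: "\<And>v. (\<Sum>x\<in>V. k x * exp (v x)) \<ge> 0 \<Longrightarrow> energy u \<le> energy v"
    and v: "(\<Sum>x\<in>V. v x * (k x * exp (u x))) > 0"
  shows "(\<Sum>x\<in>V. v x * lap u x) \<le> 0"
proof (rule ccontr)
  define Q where "Q = (\<Sum>x\<in>V. v x * lap u x)"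
  assume "\<not> (\<Sum>x\<in>V. v x * lap u x) \<le> 0"
  then have "Q > 0" by (simp add: Q_def)
  let ?f = "\<lambda>t. \<Sum>x\<in>V. k x * exp (u x + t * v x)"
  have "(?f has_real_derivative (\<Sum>x\<in>V. v x * (k x * exp (u x)))) (at 0)"
    by (auto intro!: derivative_eq_intros simp: mult_ac)
  from DERIV_pos_inc_right[OF this v] obtain d where "d > 0"
    and d: "\<And>t. 0 < t \<Longrightarrow> t < d \<Longrightarrow> ?f 0 < ?f t" by auto
  \<comment> \<open>The first bound keeps the step feasible, the second gives
    \<open>t * energy v < 4 * Q\<close>; the summand 1 avoids a zero denominator.\<close>
  define t where "t = min (d / 2) (Q / (energy v + 1))"
  have t: "0 < t" "t < d" "t \<le> Q / (energy v + 1)"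
    using \<open>d > 0\<close> \<open>Q > 0\<close> energy_nonneg[of v] by (auto simp: t_def)
  have t_le: "t * (energy v + 1) \<le> Q"
    using t(3) energy_nonneg[of v] by (simp add: pos_le_divide_eq)
  have "energy u \<le> energy (\<lambda>x. u x + t * v x)"
    using d[OF t(1,2)] feasible by (intro min) simp
  then have "t * (4 * Q) \<le> t * (t * energy v)"
    unfolding energy_add_smult by (simp add: Q_def power2_eq_square mult_ac)
  then have "4 * Q \<le> t * energy v" using t(1) by simp
  with t(1) t_le \<open>Q > 0\<close> show False by (simp add: algebra_simps)
qed

section \<open>Necessity of the sign conditions\<close>

lemma solution_imp_sign_conditions:
  fixes k :: "'a \<Rightarrow> real"
  assumes eq: "\<And>x. x \<in> V \<Longrightarrow> lap u x = - k x * exp (u x)" and k: "\<exists>x\<in>V. k x \<noteq> 0"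
  shows "\<exists>x\<in>V. k x > 0" and "\<exists>x\<in>V. k x < 0" and "(\<Sum>x\<in>V. k x) < 0"
proof -
  \<comment> \<open>Since the Laplacian sums to zero, a nonzero \<open>k\<close> of one sign is
    impossible.\<close>
  have zero: "(\<Sum>x\<in>V. k x * exp (u x)) = 0"
    using sum_lap[of u] eq by (simp add: sum_negf)
  obtain z where z: "z \<in> V" "k z \<noteq> 0" using k by blast
  show pos: "\<exists>x\<in>V. k x > 0"
  proof (rule ccontr)
    assume "\<not> (\<exists>x\<in>V. k x > 0)"
    then have le: "\<And>x. x \<in> V \<Longrightarrow> k x \<le> 0" by force
    then have "k z < 0" using z by force
    then have "(\<Sum>x\<in>V. - k x * exp (u x)) > 0"
      using z(1) finite_V le by (intro sum_pos2[of _ z]) (auto simp: mult_le_0_iff mult_less_0_iff)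
    then show False using zero by (simp add: sum_negf)
  qed
  show neg: "\<exists>x\<in>V. k x < 0"
  proof (rule ccontr)
    assume "\<not> (\<exists>x\<in>V. k x < 0)"
    then have ge: "\<And>x. x \<in> V \<Longrightarrow> k x \<ge> 0" by force
    then have "k z > 0" using z by force
    then have "(\<Sum>x\<in>V. k x * exp (u x)) > 0"
      using z(1) finite_V ge by (intro sum_pos2[of _ z]) auto
    then show False using zero by simp
  qed
  \<comment> \<open>A constant \<open>u\<close> has zero Laplacian, which forces
    \<open>k z = 0\<close>.\<close>
  have "\<exists>y\<in>V. u z \<noteq> u y"
  proof (rule ccontr)
    assume "\<not> (\<exists>y\<in>V. u z \<noteq> u y)"
    then have "lap u z = 0" by (simp add: lap_def)
    then show False using eq[OF z(1)] z(2) by simp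
  qed
  then have "(\<Sum>x\<in>V. exp (- u x) * lap u x) > 0"
    using sum_lap_exp_neg_pos z(1) by blast
  moreover have "(\<Sum>x\<in>V. exp (- u x) * lap u x) = - (\<Sum>x\<in>V. k x)"
    unfolding sum_negf[symmetric] by (intro sum.cong) (auto simp: eq exp_minus)
  ultimately show "(\<Sum>x\<in>V. k x) < 0" by simp
qed

section \<open>Sufficiency of the sign conditions\<close>

lemma exp_weighted_sum_nonneg:
  fixes k :: "'a \<Rightarrow> real"
  assumes "x \<in> V" and "k x > 0"
  shows "\<exists>u. (\<Sum>y\<in>V. k y * exp (u y)) \<ge> 0"
proof -
  define A where "A = (\<Sum>y\<in>V - {x}. \<bar>k y\<bar>)"
  \<comment> \<open>The peak at \<open>x\<close> is chosen so that its term equals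
    \<open>A + k x\<close>, while the other terms together are at least \<open>- A\<close>.\<close>
  define u where "u = (\<lambda>y. if y = x then ln (A / k x + 1) else 0)"
  have "A \<ge> 0" by (simp add: A_def sum_nonneg)
  then have "A / k x + 1 > 0" using assms(2) by (smt (verit) divide_nonneg_pos)
  then have "k x * exp (u x) = A + k x" using assms(2) by (simp add: u_def field_simps)
  moreover have "(\<Sum>y\<in>V - {x}. k y * exp (u y)) \<ge> - A"
    unfolding A_def sum_negf[symmetric] by (intro sum_mono) (auto simp: u_def)
  ultimately show ?thesis
    using assms finite_V by (intro exI[of _ u]) (simp add: sum.remove[of V x])
qed

text \<open>The vertex \<open>b\<close> serves three times: as the peak of a feasible function, as
  the point of normalisation, and as a point where the gradient of the constraint is
  nonzero.\<close>

lemma solution_if_sign_conditions: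
  fixes k :: "'a \<Rightarrow> real"
  assumes b: "b \<in> V" and ko: "k b > 0" and neg: "(\<Sum>x\<in>V. k x) < 0"
  shows "\<exists>u. \<forall>x\<in>V. lap u x = - k x * exp (u x)"
proof -
  obtain u0 where "(\<Sum>x\<in>V. k x * exp (u0 x)) \<ge> 0"
    using exp_weighted_sum_nonneg[where k = k, OF b ko] by blast
  then obtain u where u: "(\<Sum>x\<in>V. k x * exp (u x)) \<ge> 0"
    and min: "\<And>v. (\<Sum>x\<in>V. k x * exp (v x)) \<ge> 0 \<Longrightarrow> energy u \<le> energy v"
    using exp_constrained_minimiser[OF b] by blast
  have half: "(\<Sum>x\<in>V. v x * - lap u x) \<ge> 0" if "(\<Sum>x\<in>V. v x * (k x * exp (u x))) > 0" for v
    using minimiser_variation[OF u min that] by (simp add: sum_negf)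
  have nz: "k b * exp (u b) \<noteq> 0" using ko by simp
  obtain l where "l \<ge> 0" and l: "\<And>x. x \<in> V \<Longrightarrow> - lap u x = l * (k x * exp (u x))"
    using nonneg_multiplier_if_halfspace[where p = "\<lambda>x. k x * exp (u x)" and q = "\<lambda>x. - lap u x",
        OF finite_V b nz half]
    by blast
  have "l \<noteq> 0"
  proof
    assume "l = 0"
    then have "(\<Sum>x\<in>V. u x * lap u x) = 0" using l by simp
    then have const: "\<And>x. x \<in> V \<Longrightarrow> u x = u b" using sum_lap_self_neg[OF _ b, of _ u] by force
    \<comment> \<open>For constant \<open>u\<close> the constraint sum has the sign of the sum of
      \<open>k\<close>, so \<open>u\<close> would be infeasible.\<close>
    have "(\<Sum>x\<in>V. k x * exp (u x)) = (\<Sum>x\<in>V. k x) * exp (u b)"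
      unfolding sum_distrib_right using const by (intro sum.cong) auto
    then show False using u neg by (simp add: zero_le_mult_iff not_le[symmetric])
  qed
  then have "l > 0" using \<open>l \<ge> 0\<close> by simp
  have "lap (\<lambda>x. u x + ln l) x = - k x * exp (u x + ln l)" if "x \<in> V" for x
  proof -
    have "lap (\<lambda>x. u x + ln l) x = lap u x" by (simp add: lap_def)
    then show ?thesis using l[OF that] \<open>l > 0\<close> by (simp add: exp_add algebra_simps)
  qed
  then show ?thesis by (intro exI[of _ "\<lambda>x. u x + ln l"]) blast
qed

end

theorem theorem1:
  fixes G :: "'a pair_pre_digraph"
    and w :: "'a \<Rightarrow> 'a \<Rightarrow> real"
    and \<mu> h :: "'a \<Rightarrow> real"
  assumes "pair_graph G"
    and "Digraph_Component.connected (with_proj G)"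
    and "\<And>x y. x \<rightarrow>\<^bsub>with_proj G\<^esub> y \<Longrightarrow> w x y > 0"
    and "\<And>x y. x \<rightarrow>\<^bsub>with_proj G\<^esub> y \<Longrightarrow> w x y = w y x"
    and "\<And>x. x \<in> pverts G \<Longrightarrow> \<mu> x > 0"
    and "\<exists>x\<in>pverts G. h x \<noteq> 0"
  shows "(\<exists>u :: 'a \<Rightarrow> real. \<forall>x\<in>pverts G. mu_laplacian G w \<mu> u x = - h x * exp (u x))
    \<longleftrightarrow> changes_sign G h \<and> vertex_integral G \<mu> h < 0"
proof -
  interpret pair_graph G by fact
  \<comment> \<open>Extending the weights by zero turns sums over neighbours into sums over all
    vertices.\<close>
  define a where "a x y = (if x \<rightarrow>\<^bsub>with_proj G\<^esub> y then w x y else 0)" for x y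
  have adj_sym: "x \<rightarrow>\<^bsub>with_proj G\<^esub> y \<longleftrightarrow> y \<rightarrow>\<^bsub>with_proj G\<^esub> x" for x y
    using pair_sym_arcs by (auto simp: symmetric_def dest: symD)
  have reach: "(x, y) \<in> {(s, t). s \<in> pverts G \<and> t \<in> pverts G \<and> a s t > 0}\<^sup>*"
    if "x \<in> pverts G" "y \<in> pverts G" for x y
  proof -
    \<comment> \<open>Connectedness is strong connectedness of the symmetric closure; since the arcs
      are symmetric already, its paths are paths in \<open>G\<close>.\<close>
    have "(x, y) \<in> rtrancl_on (pverts G) (parcs (mk_symmetric (with_proj G)))"
      using assms(2) that unfolding Digraph_Component.connected_def strongly_connected_def reachable_def
      by auto
    then show ?thesis
    proof (induction rule: rtrancl_on_induct)
      case (step s t)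
      have "s \<rightarrow>\<^bsub>with_proj G\<^esub> t" using step.hyps(2) adj_sym by (auto simp: parcs_mk_symmetric)
      then have "a s t > 0" using assms(3) by (simp add: a_def)
      then show ?case using step by (auto intro: rtrancl_into_rtrancl)
    qed simp
  qed
  interpret W: connected_weights "pverts G" a
  proof
    show "finite (pverts G)" by (rule pair_finite_verts)
    show "a x y = a y x" for x y using assms(4) adj_sym by (auto simp: a_def)
    show "a x y \<ge> 0" for x y using assms(3) by (auto simp: a_def intro: less_imp_le)
  qed (rule reach)
  \<comment> \<open>Multiplying the equation by \<mu> moves the measure into \<open>k\<close>: the
    Laplacian loses its factor and the integral becomes a plain sum.\<close>
  define k where "k x = \<mu> x * h x" for x
  have lap: "W.lap u x = \<mu> x * mu_laplacian G w \<mu> u x" if "x \<in> pverts G" for u x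
  proof -
    have "(\<Sum>y\<in>{y. x \<rightarrow>\<^bsub>with_proj G\<^esub> y}. w x y * (u y - u x)) = W.lap u x"
      unfolding W.lap_def
      by (rule sum.mono_neutral_cong_left) (auto simp: a_def pair_finite_verts in_arcsD2)
    then show ?thesis using assms(5)[OF that] by (simp add: mu_laplacian_def)
  qed
  have "mu_laplacian G w \<mu> u x = - h x * exp (u x) \<longleftrightarrow> W.lap u x = - k x * exp (u x)"
    if "x \<in> pverts G" for u x
  proof -
    have "- k x * exp (u x) = \<mu> x * (- h x * exp (u x))" by (simp add: k_def)
    then show ?thesis using lap[OF that, of u] assms(5)[OF that] by (metis less_irrefl mult_left_cancel)
  qed
  then have solves: "(\<exists>u. \<forall>x\<in>pverts G. mu_laplacian G w \<mu> u x = - h x * exp (u x))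
      \<longleftrightarrow> (\<exists>u. \<forall>x\<in>pverts G. W.lap u x = - k x * exp (u x))"
    by simp
  have k_sign: "k x > 0 \<longleftrightarrow> h x > 0" "k x < 0 \<longleftrightarrow> h x < 0" "k x \<noteq> 0 \<longleftrightarrow> h x \<noteq> 0"
    if "x \<in> pverts G" for x
    using assms(5)[OF that] by (auto simp: k_def zero_less_mult_iff mult_less_0_iff)
  have integral: "vertex_integral G \<mu> h = (\<Sum>x\<in>pverts G. k x)"
    by (simp add: vertex_integral_def k_def)
  show ?thesis
    unfolding solves
  proof
    assume "\<exists>u. \<forall>x\<in>pverts G. W.lap u x = - k x * exp (u x)"
    then obtain u where u: "\<And>x. x \<in> pverts G \<Longrightarrow> W.lap u x = - k x * exp (u x)" by blast
    have "\<exists>x\<in>pverts G. k x \<noteq> 0" using assms(6) k_sign(3) by blast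
    note sign = W.solution_imp_sign_conditions[of u k, OF u this]
    show "changes_sign G h \<and> vertex_integral G \<mu> h < 0"
      unfolding changes_sign_def integral using sign k_sign(1,2) by blast
  next
    assume "changes_sign G h \<and> vertex_integral G \<mu> h < 0"
    then obtain x where "x \<in> pverts G" "k x > 0" "(\<Sum>x\<in>pverts G. k x) < 0"
      unfolding changes_sign_def integral using k_sign(1) by blast
    then show "\<exists>u. \<forall>x\<in>pverts G. W.lap u x = - k x * exp (u x)"
      by (rule W.solution_if_sign_conditions)
  qed
qed

end
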